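(* Let $D,\widehat{D}$ be symmetric slice domains in $\mathbb{H}$. For every $\mathbb{R}$-algebra homomorphism $\phi:\mathcal{O}_s(D)\to\mathcal{O}_s(\widehat{D})$ there exists a unique map $h:\widehat{D}\to D$ such that $\phi(f)=f\circ h$ for all $f\in\mathcal{O}_s(D)$. More precisely: (i) $h=\phi(\mathrm{id}_D)\in\mathcal{O}_s(\widehat{D})$, where $\mathrm{id}_D$ is the identity map defined by $\mathrm{id}_D(q)=q$ for every $q\in D$; and (ii) $\phi$ is bijective if and only if $h$ is bi-regular.
   Context: $\mathbb{H}$ denotes the real quaternions, $\mathbb{S}=\{I\in\mathbb{H}: I^2=-1\}$, and for $I\in\mathbb{S}$, $\mathbb{C}_I=\mathbb{R}+I\mathbb{R}$. A domain is a nonempty connected open subset of $\mathbb{H}\cong\mathbb{R}^4$ (resp. of $\mathbb{C}_I$). A symmetric slice domain is a domain $D\subset\mathbb{H}$ such that $D\cap\mathbb{R}\neq\emptyset$, $D\cap\mathbb{C}_I$ is a domain in $\mathbb{C}_I$ for every $I\in\mathbb{S}$, and whenever $x+Iy\in D$ ($x,y\in\mathbb{R}$, $I\in\mathbb{S}$) then $x+Jy\in D$ for all $J\in\mathbb{S}$. A function $f:D\to\mathbb{H}$ is regular if for every $I\in\mathbb{S}$ its restriction $f_I$ to $D\cap\mathbb{C}_I$ has continuous partial derivatives and satisfies $\frac12\left(\frac{\partial}{\partial x}+I\frac{\partial}{\partial y}\right)f_I(x+Iy)=0$ for all $x+Iy\in D\cap\mathbb{C}_I$. A regular $f$ is slice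 preserving if $f(D\cap\mathbb{C}_I)\subset\mathbb{C}_I$ for every $I\in\mathbb{S}$. $\mathcal{O}_s(D)$ is the set of slice preserving regular functions on $D$; with pointwise addition, multiplication and real scalar multiplication it is a commutative $\mathbb{R}$-algebra (and an integral domain). An $\mathbb{R}$-algebra homomorphism is a map that is additive, compatible with multiplication by real scalars, and multiplicative. A map $h:\widehat D\to D$ is bi-regular if it is regular and bijective with regular inverse $D\to\widehat D$.
   Formalization: The homomorphism φ is assumed not to be the zero map: with homomorphisms not required to preserve the unit, the zero map is a homomorphism that is not of the form f ↦ f∘h (take f = 1), so the claim fails for it alone. *)

theory Defs
  imports "HOL-Analysis.Analysis" "HOL-Library.FuncSet"
begin

section \<open>The real quaternions\<close>

datatype quat = Quat (q0: real) (q1: real) (q2: real) (q3: real)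

lemma quat_eqI:
  "q0 p = q0 q \<Longrightarrow> q1 p = q1 q \<Longrightarrow> q2 p = q2 q \<Longrightarrow> q3 p = q3 q \<Longrightarrow> p = q"
  by (rule quat.expand) simp

lemma quat_eq_iff: "p = q \<longleftrightarrow> q0 p = q0 q \<and> q1 p = q1 q \<and> q2 p = q2 q \<and> q3 p = q3 q"
  by (auto intro: quat_eqI)

instantiation quat :: ring_1
begin

definition "0 = Quat 0 0 0 0"
definition "1 = Quat 1 0 0 0"
definition "p + q = Quat (q0 p + q0 q) (q1 p + q1 q) (q2 p + q2 q) (q3 p + q3 q)"
definition "p - q = Quat (q0 p - q0 q) (q1 p - q1 q) (q2 p - q2 q) (q3 p - q3 q)"
definition "- p = Quat (- q0 p) (- q1 p) (- q2 p) (- q3 p)"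
definition "p * q =
  Quat (q0 p * q0 q - q1 p * q1 q - q2 p * q2 q - q3 p * q3 q)
       (q0 p * q1 q + q1 p * q0 q + q2 p * q3 q - q3 p * q2 q)
       (q0 p * q2 q - q1 p * q3 q + q2 p * q0 q + q3 p * q1 q)
       (q0 p * q3 q + q1 p * q2 q - q2 p * q1 q + q3 p * q0 q)"

instance
  by standard
    (simp_all add: quat_eq_iff zero_quat_def one_quat_def plus_quat_def minus_quat_def
      uminus_quat_def times_quat_def algebra_simps)

end

lemma quat_sel_arith [simp]:
  "q0 0 = 0" "q1 0 = 0" "q2 0 = 0" "q3 0 = 0"
  "q0 1 = 1" "q1 1 = 0" "q2 1 = 0" "q3 1 = 0"
  "q0 (p + q) = q0 p + q0 q" "q1 (p + q) = q1 p + q1 q"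
  "q2 (p + q) = q2 p + q2 q" "q3 (p + q) = q3 p + q3 q"
  "q0 (p - q) = q0 p - q0 q" "q1 (p - q) = q1 p - q1 q"
  "q2 (p - q) = q2 p - q2 q" "q3 (p - q) = q3 p - q3 q"
  "q0 (- p) = - q0 p" "q1 (- p) = - q1 p" "q2 (- p) = - q2 p" "q3 (- p) = - q3 p"
  "q0 (p * q) = q0 p * q0 q - q1 p * q1 q - q2 p * q2 q - q3 p * q3 q"
  "q1 (p * q) = q0 p * q1 q + q1 p * q0 q + q2 p * q3 q - q3 p * q2 q"
  "q2 (p * q) = q0 p * q2 q - q1 p * q3 q + q2 p * q0 q + q3 p * q1 q"
  "q3 (p * q) = q0 p * q3 q + q1 p * q2 q - q2 p * q1 q + q3 p * q0 q"
  by (simp_all add: zero_quat_def one_quat_def plus_quat_def minus_quat_def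
      uminus_quat_def times_quat_def)

instantiation quat :: real_algebra_1
begin

definition "r *\<^sub>R q = Quat (r * q0 q) (r * q1 q) (r * q2 q) (r * q3 q)"

instance
  by standard (simp_all add: quat_eq_iff scaleR_quat_def algebra_simps)

end

lemma quat_sel_scaleR [simp]:
  "q0 (r *\<^sub>R q) = r * q0 q" "q1 (r *\<^sub>R q) = r * q1 q"
  "q2 (r *\<^sub>R q) = r * q2 q" "q3 (r *\<^sub>R q) = r * q3 q"
  by (simp_all add: scaleR_quat_def)

lemma quat_sel_of_real [simp]:
  "q0 (of_real r) = r" "q1 (of_real r) = 0" "q2 (of_real r) = 0" "q3 (of_real r) = 0"
  by (simp_all add: of_real_def)

instantiation quat :: real_inner
begin

definition "p \<bullet> q = q0 p * q0 q + q1 p * q1 q + q2 p * q2 q + q3 p * q3 q"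
definition "norm (q::quat) = sqrt (q \<bullet> q)"
definition "dist (p::quat) q = norm (p - q)"
definition "sgn (q::quat) = q /\<^sub>R norm q"
definition [code del]: "(uniformity :: (quat \<times> quat) filter) =
  (INF e\<in>{0<..}. principal {(x, y). dist x y < e})"
definition [code del]: "open (U :: quat set) \<longleftrightarrow>
  (\<forall>x\<in>U. eventually (\<lambda>(x', y). x' = x \<longrightarrow> y \<in> U) uniformity)"

instance
proof
  fix p q r :: quat and a :: real
  show "p \<bullet> q = q \<bullet> p" "(p + q) \<bullet> r = p \<bullet> r + q \<bullet> r" "(a *\<^sub>R p) \<bullet> q = a * (p \<bullet> q)"
    by (simp_all add: inner_quat_def algebra_simps)
  show nonneg: "0 \<le> p \<bullet> p"
    by (simp add: inner_quat_def)
  show "p \<bullet> p = 0 \<longleftrightarrow> p = 0"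
    by (simp add: inner_quat_def quat_eq_iff add_nonneg_eq_0_iff)
qed (simp_all add: norm_quat_def dist_quat_def sgn_quat_def uniformity_quat_def open_quat_def)

end

instantiation quat :: real_normed_div_algebra
begin

definition "inverse q =
  Quat (q0 q / (norm q)\<^sup>2) (- q1 q / (norm q)\<^sup>2) (- q2 q / (norm q)\<^sup>2) (- q3 q / (norm q)\<^sup>2)"
definition "p div q = p * inverse (q::quat)"

instance
proof
  fix p q :: quat
  show "inverse p * p = 1" "p * inverse p = 1" if "p \<noteq> 0"
  proof -
    define n and c where "n = (norm p)\<^sup>2" and "c = Quat (q0 p) (- q1 p) (- q2 p) (- q3 p)"
    have n: "n = q0 p * q0 p + q1 p * q1 p + q2 p * q2 p + q3 p * q3 p"
      by (simp add: n_def power2_norm_eq_inner inner_quat_def)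
    have "n \<noteq> 0" using that by (simp add: n_def)
    moreover have "inverse p = (1 / n) *\<^sub>R c"
      by (simp add: quat_eq_iff inverse_quat_def n_def c_def)
    moreover have "c * p = n *\<^sub>R 1" "p * c = n *\<^sub>R 1"
      by (simp_all add: quat_eq_iff c_def n)
    ultimately show "inverse p * p = 1" "p * inverse p = 1"
      by simp_all
  qed
  show "inverse (0::quat) = 0"
    by (simp add: inverse_quat_def quat_eq_iff)
  show "norm (p * q) = norm p * norm q"
    unfolding norm_quat_def inner_quat_def real_sqrt_mult[symmetric] quat_sel_arith
    by (rule arg_cong[where f = sqrt]) algebra
qed (rule divide_quat_def)

end

instantiation quat :: euclidean_space
begin

definition "Basis = {Quat 1 0 0 0, Quat 0 1 0 0, Quat 0 0 1 0, Quat 0 0 0 1}"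

instance
proof
  fix x :: quat
  show "(\<forall>u\<in>Basis. x \<bullet> u = 0) \<longleftrightarrow> x = 0"
    by (simp add: Basis_quat_def inner_quat_def) (simp add: quat_eq_iff)
qed (auto simp: Basis_quat_def inner_quat_def)

end

section \<open>Slices and symmetric slice domains\<close>

definition imag_units :: "quat set" where
  "imag_units = {I. I\<^sup>2 = -1}"

definition slice_pt :: "quat \<Rightarrow> real \<Rightarrow> real \<Rightarrow> quat" where
  "slice_pt I x y = of_real x + I * of_real y"

definition slice_plane :: "quat \<Rightarrow> quat set" where
  "slice_plane I = {slice_pt I x y | x y. True}"

definition domain_in :: "quat set \<Rightarrow> quat set \<Rightarrow> bool" where
  "domain_in X U \<longleftrightarrow> U \<noteq> {} \<and> connected U \<and> openin (top_of_set X) U"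

definition symmetric_slice_domain :: "quat set \<Rightarrow> bool" where
  "symmetric_slice_domain D \<longleftrightarrow>
     domain_in UNIV D \<and>
     D \<inter> \<real> \<noteq> {} \<and>
     (\<forall>I\<in>imag_units. domain_in (slice_plane I) (D \<inter> slice_plane I)) \<and>
     (\<forall>x y. \<forall>I\<in>imag_units. slice_pt I x y \<in> D \<longrightarrow> (\<forall>J\<in>imag_units. slice_pt J x y \<in> D))"

section \<open>Slice preserving regular functions\<close>

text \<open>For open \<open>D\<close>, each partial derivative at a point of \<open>D \<inter> slice_plane I\<close> only depends on
  values of \<open>f\<close> inside \<open>D\<close>. The imaginary unit acts by multiplication from the left.\<close>

definition regular_on :: "quat set \<Rightarrow> (quat \<Rightarrow> quat) \<Rightarrow> bool" where
  "regular_on D f \<longleftrightarrow>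
     (\<forall>I\<in>imag_units. \<exists>fx fy.
        continuous_on {(x, y). slice_pt I x y \<in> D} (\<lambda>(x, y). fx x y) \<and>
        continuous_on {(x, y). slice_pt I x y \<in> D} (\<lambda>(x, y). fy x y) \<and>
        (\<forall>x y. slice_pt I x y \<in> D \<longrightarrow>
           ((\<lambda>t. f (slice_pt I t y)) has_vector_derivative fx x y) (at x) \<and>
           ((\<lambda>t. f (slice_pt I x t)) has_vector_derivative fy x y) (at y) \<and>
           (1 / 2) *\<^sub>R (fx x y + I * fy x y) = 0))"

definition slice_preserving :: "quat set \<Rightarrow> (quat \<Rightarrow> quat) \<Rightarrow> bool" where
  "slice_preserving D f \<longleftrightarrow> (\<forall>I\<in>imag_units. f ` (D \<inter> slice_plane I) \<subseteq> slice_plane I)"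

text \<open>A function on \<open>D\<close> is represented by its unique extensional representative (equal to
  \<open>undefined\<close> outside \<open>D\<close>), so that equality in \<open>\<O>\<^sub>s D\<close> is equality of functions on \<open>D\<close>.\<close>

definition slice_preserving_regular :: "quat set \<Rightarrow> (quat \<Rightarrow> quat) set" ("\<O>\<^sub>s") where
  "\<O>\<^sub>s D = {f \<in> D \<rightarrow>\<^sub>E UNIV. regular_on D f \<and> slice_preserving D f}"

text \<open>Preservation of the unit is not part of this notion, so the zero map satisfies it.\<close>

definition real_algebra_hom ::
  "quat set \<Rightarrow> quat set \<Rightarrow> ((quat \<Rightarrow> quat) \<Rightarrow> (quat \<Rightarrow> quat)) \<Rightarrow> bool" where
  "real_algebra_hom D D' \<phi> \<longleftrightarrow>
     \<phi> \<in> \<O>\<^sub>s D \<rightarrow> \<O>\<^sub>s D' \<and>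
     (\<forall>f\<in>\<O>\<^sub>s D. \<forall>g\<in>\<O>\<^sub>s D. \<phi> (\<lambda>q\<in>D. f q + g q) = (\<lambda>q\<in>D'. \<phi> f q + \<phi> g q)) \<and>
     (\<forall>c::real. \<forall>f\<in>\<O>\<^sub>s D. \<phi> (\<lambda>q\<in>D. c *\<^sub>R f q) = (\<lambda>q\<in>D'. c *\<^sub>R \<phi> f q)) \<and>
     (\<forall>f\<in>\<O>\<^sub>s D. \<forall>g\<in>\<O>\<^sub>s D. \<phi> (\<lambda>q\<in>D. f q * g q) = (\<lambda>q\<in>D'. \<phi> f q * \<phi> g q))"

definition biregular :: "quat set \<Rightarrow> quat set \<Rightarrow> (quat \<Rightarrow> quat) \<Rightarrow> bool" where
  "biregular D' D h \<longleftrightarrow>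
     regular_on D' h \<and> bij_betw h D' D \<and> regular_on D (the_inv_into D' h)"

end

theory Submission
  imports Defs "HOL-Complex_Analysis.Conformal_Mappings"
begin

text \<open>
  A slice preserving regular function on \<open>D\<close> is one holomorphic function in disguise. Every slice
  \<open>slice_plane J\<close> is a copy of the complex plane, the embedding \<open>emb J\<close> carries the same open
  connected set \<open>profile D\<close>, symmetric about the real axis, onto each \<open>D \<inter> slice_plane J\<close>, and
  regularity is the Cauchy--Riemann system. On real points all the resulting holomorphic functions take
  the same real value, so by the identity theorem they are a single stem function \<open>F\<close> with
  \<open>f (emb J z) = emb J (F z)\<close> for every \<open>J\<close> (\<open>stem_exists\<close>). Stem functions commute with conjugation,
  and every holomorphic function that does so is a stem function (\<open>lift_stem\<close>). Hence \<open>\<O>\<^sub>s D\<close> is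
  the algebra of conjugation symmetric holomorphic functions on \<open>profile D\<close>.

  Let \<open>\<phi>\<close> be a nonzero homomorphism. Since \<open>\<phi> 1\<close> is idempotent and its stem function lives
  on a connected set, it is 0 or 1, and 0 would force \<open>\<phi> = 0\<close>. Put \<open>h = \<phi> id\<close>, called
  \<open>point_map\<close> below; then \<open>\<phi>\<close> sends a
  real polynomial \<open>p\<close> to \<open>p \<circ> h\<close>. Two facts about real quadratics do the rest.
  If \<open>h q = a\<close> were outside \<open>D\<close>, then the real quadratic vanishing on the sphere of \<open>a\<close> would have no zero
  in \<open>D\<close>, hence be a unit of \<open>\<O>\<^sub>s D\<close>; its image would be a unit with a zero at \<open>q\<close>
  (\<open>point_map_in\<close>). If \<open>a = h q\<close> lies in \<open>D\<close>, then any \<open>f\<close> in \<open>\<O>\<^sub>s D\<close> is \<open>l + p * g\<close> with \<open>l\<close>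
  real affine, \<open>p\<close> a real polynomial of degree at most 2 vanishing at \<open>a\<close>, and \<open>g\<close> in \<open>\<O>\<^sub>s D\<close>
  (\<open>interpolation\<close>). Applying \<open>\<phi>\<close> and evaluating at \<open>q\<close> leaves \<open>l a\<close>, which is \<open>f a\<close>
  (\<open>hom_eq_evaluation\<close>).
  Uniqueness of \<open>h\<close> comes from applying the equation to the identity function.

  For a bijective \<open>\<phi>\<close> the same argument applies to its inverse and yields a map inverse to \<open>h\<close>.
  Conversely, the inverse of a bi-regular \<open>h\<close> is again slice preserving
  (\<open>slice_preserving_inverse\<close>), and composition with it inverts \<open>\<phi>\<close>.
\<close>

section \<open>Slices as copies of the complex plane\<close>

definition emb :: "quat \<Rightarrow> complex \<Rightarrow> quat" where
  "emb J z = slice_pt J (Re z) (Im z)"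

text \<open>The orthogonal projection to \<open>slice_plane J\<close>, read as a complex number. Unlike an inverse of
  \<open>emb J\<close> that is meaningful on the slice only, it is linear on all of \<open>quat\<close>, so derivatives may be
  pushed through it.\<close>

definition coord :: "quat \<Rightarrow> quat \<Rightarrow> complex" where
  "coord J q = Complex (q0 q) (J \<bullet> q)"

lemma slice_pt_eq_emb: "slice_pt J x y = emb J (Complex x y)"
  by (simp add: emb_def)

lemma imag_units_iff:
  "J \<in> imag_units \<longleftrightarrow> q0 J = 0 \<and> q1 J * q1 J + q2 J * q2 J + q3 J * q3 J = 1"
proof
  assume "J \<in> imag_units"
  then have *: "q0 J * q0 J - q1 J * q1 J - q2 J * q2 J - q3 J * q3 J = -1"
      "q0 J * q1 J = 0" "q0 J * q2 J = 0" "q0 J * q3 J = 0"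
    by (auto simp: imag_units_def power2_eq_square quat_eq_iff algebra_simps)
  have "q0 J = 0"
  proof (rule ccontr)
    assume "q0 J \<noteq> 0"
    with * have "q0 J * q0 J = -1" by simp
    then show False by (metis neg_0_le_iff_le not_one_le_zero zero_le_square)
  qed
  with * show "q0 J = 0 \<and> q1 J * q1 J + q2 J * q2 J + q3 J * q3 J = 1" by simp
qed (auto simp: imag_units_def power2_eq_square quat_eq_iff algebra_simps)

lemma imag_unitsD:
  assumes "J \<in> imag_units"
  shows "q0 J = 0" "q1 J * q1 J + q2 J * q2 J + q3 J * q3 J = 1"
  using assms by (simp_all add: imag_units_iff)

lemma imag_units_uminus: "J \<in> imag_units \<Longrightarrow> - J \<in> imag_units"
  by (simp add: imag_units_def)

lemma imag_units_square: "J \<in> imag_units \<Longrightarrow> J * J = -1"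
  by (simp add: imag_units_def power2_eq_square)

lemma standard_imag_units: "Quat 0 1 0 0 \<in> imag_units" "Quat 0 0 1 0 \<in> imag_units"
  by (simp_all add: imag_units_iff)

lemma emb_sel:
  assumes "J \<in> imag_units"
  shows "q0 (emb J z) = Re z" "q1 (emb J z) = q1 J * Im z"
    "q2 (emb J z) = q2 J * Im z" "q3 (emb J z) = q3 J * Im z"
  using assms by (simp_all add: emb_def slice_pt_def imag_units_iff)

lemma emb_add: "emb J (z + w) = emb J z + emb J w"
  and emb_scaleR: "emb J (c *\<^sub>R z) = c *\<^sub>R emb J z"
  and emb_0: "emb J 0 = 0"
  and emb_1: "emb J 1 = 1"
  and emb_of_real: "emb J (of_real c) = of_real c"
  by (simp_all add: emb_def slice_pt_def algebra_simps quat_eq_iff)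

lemma emb_mult:
  assumes "J \<in> imag_units"
  shows "emb J (z * w) = emb J z * emb J w"
proof -
  have "J * of_real (Im z) * (J * of_real (Im w)) = (J * J) * of_real (Im z * Im w)"
    by (simp add: quat_eq_iff algebra_simps)
  also have "\<dots> = - of_real (Im z * Im w)"
    by (simp add: imag_units_square[OF assms])
  finally show ?thesis
    by (simp add: emb_def slice_pt_def quat_eq_iff algebra_simps)
qed

lemma emb_i_mult: "J \<in> imag_units \<Longrightarrow> emb J (\<i> * z) = J * emb J z"
  by (simp add: emb_mult) (simp add: emb_def slice_pt_def)

lemma emb_uminus: "emb (- J) z = emb J (cnj z)"
  by (simp add: emb_def slice_pt_def)

lemma bounded_linear_emb: "bounded_linear (emb J)"
  by (intro linear_conv_bounded_linear[THEN iffD1] linearI emb_add emb_scaleR)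

lemma bounded_linear_coord: "bounded_linear (coord J)"
  by (intro linear_conv_bounded_linear[THEN iffD1] linearI)
    (simp_all add: coord_def complex_eq_iff inner_add_right)

lemma coord_emb:
  assumes "J \<in> imag_units"
  shows "coord J (emb J z) = z"
proof -
  have "J \<bullet> emb J z = (q1 J * q1 J + q2 J * q2 J + q3 J * q3 J) * Im z"
    using imag_unitsD(1)[OF assms] by (simp add: inner_quat_def emb_sel[OF assms] algebra_simps)
  then show ?thesis
    by (simp add: coord_def emb_sel[OF assms] imag_unitsD[OF assms])
qed

text \<open>This turns the quaternionic Cauchy--Riemann equation, with \<open>J\<close> multiplying from the left,
  into the complex one.\<close>

lemma coord_mult_unit:
  assumes "J \<in> imag_units"
  shows "coord J (J * q) = \<i> * coord J q"
proof -
  have "J \<bullet> (J * q) = (q1 J * q1 J + q2 J * q2 J + q3 J * q3 J) * q0 q"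
    using imag_unitsD(1)[OF assms] by (simp add: inner_quat_def algebra_simps)
  then show ?thesis
    by (simp add: coord_def complex_eq_iff imag_unitsD[OF assms]) (simp add: inner_quat_def imag_unitsD[OF assms])
qed

lemma emb_eq_iff: "J \<in> imag_units \<Longrightarrow> emb J z = emb J w \<longleftrightarrow> z = w"
  by (metis coord_emb)

lemma slice_plane_eq: "slice_plane J = range (emb J)"
  by (auto simp: slice_plane_def slice_pt_eq_emb) (metis complex_surj)

lemma quat_in_slice:
  obtains J z where "J \<in> imag_units" "q = emb J z"
proof (cases "q1 q = 0 \<and> q2 q = 0 \<and> q3 q = 0")
  case True
  then have "q = emb (Quat 0 1 0 0) (Complex (q0 q) 0)"
    by (simp add: quat_eq_iff emb_sel standard_imag_units)
  then show ?thesis using that standard_imag_units by force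
next
  case False
  define r where "r = sqrt (q1 q * q1 q + q2 q * q2 q + q3 q * q3 q)"
  have r2: "r * r = q1 q * q1 q + q2 q * q2 q + q3 q * q3 q"
    by (simp add: r_def)
  have "r > 0"
    using False unfolding r_def
    by (metis add_nonneg_eq_0_iff add_nonneg_nonneg less_eq_real_def mult_eq_0_iff
        real_sqrt_gt_0_iff zero_le_square)
  define J where "J = Quat 0 (q1 q / r) (q2 q / r) (q3 q / r)"
  have "q1 J * q1 J + q2 J * q2 J + q3 J * q3 J = (r * r) / (r * r)"
    unfolding J_def quat.sel times_divide_times_eq add_divide_distrib[symmetric] r2 ..
  then have J: "J \<in> imag_units"
    using \<open>r > 0\<close> by (simp add: imag_units_iff J_def)
  moreover have "q = emb J (Complex (q0 q) r)"
    using \<open>r > 0\<close> J by (simp add: quat_eq_iff emb_sel) (simp add: J_def)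
  ultimately show ?thesis using that \<open>r > 0\<close> by force
qed

text \<open>Distinct slices meet in the real line only; two perpendicular ones make this visible on
  coordinates.\<close>

lemma in_two_slices_real:
  assumes "q \<in> slice_plane (Quat 0 1 0 0)" "q \<in> slice_plane (Quat 0 0 1 0)"
  shows "q = of_real (q0 q)"
  using assms by (auto simp: slice_plane_eq quat_eq_iff emb_sel standard_imag_units)

section \<open>The profile of a symmetric slice domain\<close>

text \<open>The common trace of \<open>D\<close> on all slices. Quantifying over all units avoids singling one out;
  for a symmetric slice domain any one of them gives the same set (\<open>emb_in_iff\<close>).\<close>

definition profile :: "quat set \<Rightarrow> complex set" where
  "profile D = {z. \<forall>J\<in>imag_units. emb J z \<in> D}"

lemma emb_in_iff:
  assumes "symmetric_slice_domain D" "J \<in> imag_units"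
  shows "emb J z \<in> D \<longleftrightarrow> z \<in> profile D"
  using assms unfolding profile_def symmetric_slice_domain_def emb_def by blast

text \<open>Replacing \<open>J\<close> by \<open>- J\<close> is complex conjugation in the coordinate, so symmetry under change
  of the unit contains symmetry about the real axis.\<close>

lemma profile_cnj:
  assumes "symmetric_slice_domain D"
  shows "cnj z \<in> profile D \<longleftrightarrow> z \<in> profile D"
  using emb_in_iff[OF assms standard_imag_units(1)]
    emb_in_iff[OF assms imag_units_uminus[OF standard_imag_units(1)]]
  by (metis emb_uminus)

lemma domain_point:
  assumes "symmetric_slice_domain D" "q \<in> D"
  obtains J z where "J \<in> imag_units" "z \<in> profile D" "q = emb J z"
  using quat_in_slice[of q] emb_in_iff assms by metis

lemma open_domain: "symmetric_slice_domain D \<Longrightarrow> open D"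
  by (simp add: symmetric_slice_domain_def domain_in_def)

lemma open_profile:
  assumes "symmetric_slice_domain D"
  shows "open (profile D)"
proof -
  have "profile D = emb (Quat 0 1 0 0) -` D"
    using emb_in_iff[OF assms standard_imag_units(1)] by auto
  then show ?thesis
    using open_domain[OF assms]
    by (simp add: open_vimage linear_continuous_on bounded_linear_emb)
qed

lemma connected_profile:
  assumes "symmetric_slice_domain D"
  shows "connected (profile D)"
proof -
  let ?i = "Quat 0 1 0 0"
  have "profile D = coord ?i ` (D \<inter> slice_plane ?i)"
    using emb_in_iff[OF assms standard_imag_units(1)]
    by (force simp: slice_plane_eq coord_emb standard_imag_units image_iff)
  moreover have "connected (D \<inter> slice_plane ?i)"
    using assms standard_imag_units by (auto simp: symmetric_slice_domain_def domain_in_def)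
  ultimately show ?thesis
    by (simp add: connected_continuous_image linear_continuous_on bounded_linear_coord)
qed

lemma profile_meets_reals:
  assumes "symmetric_slice_domain D"
  obtains x :: real where "of_real x \<in> profile D"
proof -
  obtain x where "of_real x \<in> D"
    using assms by (auto simp: symmetric_slice_domain_def Reals_def)
  then have "emb (Quat 0 1 0 0) (of_real x) \<in> D" by (simp only: emb_of_real)
  then show ?thesis using emb_in_iff[OF assms standard_imag_units(1)] that by blast
qed

text \<open>The identity theorem in the form needed here: \<open>profile D\<close> is connected, and being open it
  contains an interval around each of its real points.\<close>

lemma holomorphic_eq_on_reals:
  assumes D: "symmetric_slice_domain D"
    and "F holomorphic_on profile D" "G holomorphic_on profile D"
    and eq: "\<And>x. of_real x \<in> profile D \<Longrightarrow> F (of_real x) = G (of_real x)"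
    and z: "z \<in> profile D"
  shows "F z = G z"
proof -
  obtain x0 where x0: "of_real x0 \<in> profile D" using profile_meets_reals[OF D] .
  have "complex_of_real x0 islimpt (profile D \<inter> \<real>)"
    unfolding islimpt_approachable
  proof (intro allI impI)
    fix e :: real assume "e > 0"
    obtain d where d: "d > 0" "ball (complex_of_real x0) d \<subseteq> profile D"
      using open_profile[OF D] x0 open_contains_ball by blast
    let ?y = "complex_of_real (x0 + min d e / 2)"
    have *: "dist (complex_of_real x0) ?y = min d e / 2"
      using \<open>e > 0\<close> \<open>d > 0\<close> by (simp only: dist_of_real) (simp add: dist_real_def)
    with d \<open>e > 0\<close> have "?y \<in> profile D" by (intro subsetD[OF d(2)]) auto
    moreover have "?y \<noteq> complex_of_real x0"
      using d \<open>e > 0\<close> by (simp only: of_real_eq_iff)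
    moreover have "dist ?y (complex_of_real x0) < e"
      using * d \<open>e > 0\<close> by (simp add: dist_commute)
    moreover have "?y \<in> \<real>" by simp
    ultimately show "\<exists>x'\<in>profile D \<inter> \<real>. x' \<noteq> complex_of_real x0 \<and> dist x' (complex_of_real x0) < e"
      by (intro bexI[of _ ?y] conjI IntI)
  qed
  moreover have "F w - G w = 0" if "w \<in> profile D \<inter> \<real>" for w
    using that eq by (auto simp: Reals_def)
  ultimately have "F z - G z = 0"
    by (intro analytic_continuation[OF holomorphic_on_diff[OF assms(2,3)] open_profile[OF D]
          connected_profile[OF D] Int_lower1 x0 _ _ z])
  then show ?thesis by simp
qed

section \<open>Regularity and holomorphy on a slice\<close>

text \<open>Continuous partial derivatives give total differentiability on the slice, and the
  Cauchy--Riemann equation makes the total derivative multiplication by a complex number.\<close>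

lemma regular_imp_holomorphic:
  assumes D: "symmetric_slice_domain D" and reg: "regular_on D f" and J: "J \<in> imag_units"
  shows "(\<lambda>z. coord J (f (emb J z))) holomorphic_on profile D"
proof -
  define V where "V = {(x, y). slice_pt J x y \<in> D}"
  obtain fx fy where "continuous_on {(x, y). slice_pt J x y \<in> D} (\<lambda>(x, y). fy x y)"
    and partials: "\<And>x y. slice_pt J x y \<in> D \<Longrightarrow>
           ((\<lambda>t. f (slice_pt J t y)) has_vector_derivative fx x y) (at x) \<and>
           ((\<lambda>t. f (slice_pt J x t)) has_vector_derivative fy x y) (at y) \<and>
           (1 / 2) *\<^sub>R (fx x y + J * fy x y) = 0"
    using reg J unfolding regular_on_def by blast
  then have cont: "continuous_on V (\<lambda>(x, y). fy x y)" by (simp add: V_def)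
  have fx: "((\<lambda>t. f (slice_pt J t y)) has_vector_derivative fx x y) (at x)"
    and fy: "((\<lambda>t. f (slice_pt J x t)) has_vector_derivative fy x y) (at y)"
    and CR: "(1 / 2) *\<^sub>R (fx x y + J * fy x y) = 0" if "(x, y) \<in> V" for x y
    using partials[of x y] that by (simp_all add: V_def)
  have V_iff: "(x, y) \<in> V \<longleftrightarrow> Complex x y \<in> profile D" for x y
    using emb_in_iff[OF D J] by (simp add: V_def slice_pt_eq_emb)
  have "V = (\<lambda>p. Complex (fst p) (snd p)) -` profile D"
    using V_iff by auto
  moreover have "continuous_on UNIV (\<lambda>p::real\<times>real. Complex (fst p) (snd p))"
    by (auto simp: Complex_eq intro!: continuous_intros)
  ultimately have "open V"
    using open_profile[OF D] by (simp add: open_vimage)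
  note bl = bounded_linear_coord[of J]
  let ?g = "\<lambda>x y. coord J (f (slice_pt J x y))"
  have "\<exists>d. ((\<lambda>z. coord J (f (emb J z))) has_field_derivative d) (at z0)" if "z0 \<in> profile D" for z0
  proof -
    define x0 y0 where "x0 = Re z0" and "y0 = Im z0"
    have "(x0, y0) \<in> V" using that by (simp add: V_iff x0_def y0_def)
    from open_prod_elim[OF \<open>open V\<close> this]
    obtain A B where AB: "open A" "open B" "A \<times> B \<subseteq> V" and "(x0, y0) \<in> A \<times> B" .
    then have x0: "x0 \<in> A" and "y0 \<in> B" by simp_all
    then obtain e where e: "e > 0" "ball y0 e \<subseteq> B"
      using \<open>open B\<close> unfolding open_contains_ball by meson
    \<comment> \<open>A product neighbourhood, with the second factor convex: continuity of one partial derivative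
      is used through the mean value theorem along vertical segments.\<close>
    define Y where "Y = ball y0 e"
    have Y: "open Y" "convex Y" "y0 \<in> Y" "A \<times> Y \<subseteq> V"
    proof -
      show "A \<times> Y \<subseteq> V" using e(2) AB(3) unfolding Y_def by fast
    qed (use e(1) in \<open>simp_all add: Y_def\<close>)
    have "((\<lambda>(x, y). ?g x y) has_derivative
        (\<lambda>(tx, ty). tx *\<^sub>R coord J (fx x0 y0) + blinfun_scaleR_left (coord J (fy x0 y0)) ty))
        (at (x0, y0) within A \<times> Y)"
    proof (rule has_derivative_partialsI[where fy = "\<lambda>x y. blinfun_scaleR_left (coord J (fy x y))"])
      show "((\<lambda>x. ?g x y0) has_derivative (\<lambda>tx. tx *\<^sub>R coord J (fx x0 y0))) (at x0 within A)"
        using bounded_linear.has_vector_derivative[OF bl fx[OF \<open>(x0, y0) \<in> V\<close>]]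
        unfolding has_vector_derivative_def by (rule has_derivative_at_withinI)
      show "((\<lambda>y. ?g x y) has_derivative blinfun_apply (blinfun_scaleR_left (coord J (fy x y))))
          (at y within Y)" if "x \<in> A" "y \<in> Y" for x y
      proof -
        have "(x, y) \<in> V" using that Y(4) by auto
        from bounded_linear.has_vector_derivative[OF bl fy[OF this]] show ?thesis
          unfolding has_vector_derivative_def by (simp add: has_derivative_at_withinI)
      qed
      have "continuous_on V (\<lambda>p. blinfun_scaleR_left (coord J ((\<lambda>(x, y). fy x y) p)))"
        by (intro bounded_linear.continuous_on[OF bounded_linear_blinfun_scaleR_left]
            bounded_linear.continuous_on[OF bl] cont)
      then have "continuous (at (x0, y0)) (\<lambda>p. blinfun_scaleR_left (coord J ((\<lambda>(x, y). fy x y) p)))"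
        using \<open>open V\<close> \<open>(x0, y0) \<in> V\<close> by (simp add: continuous_on_eq_continuous_at)
      then show "continuous (at (x0, y0) within A \<times> Y)
          (\<lambda>(x, y). blinfun_scaleR_left (coord J (fy x y)))"
        by (simp add: case_prod_unfold continuous_at_imp_continuous_at_within)
    qed (rule Y)+
    then have der: "((\<lambda>(x, y). ?g x y) has_derivative
        (\<lambda>(tx, ty). tx *\<^sub>R coord J (fx x0 y0) + ty *\<^sub>R coord J (fy x0 y0))) (at (x0, y0))"
      using at_within_open[OF _ open_Times[OF AB(1) Y(1)], of "(x0, y0)"] x0 Y(3) by simp
    have "fx x0 y0 + J * fy x0 y0 = 0"
      using CR[OF \<open>(x0, y0) \<in> V\<close>] by simp
    then have "J * fx x0 y0 + J * J * fy x0 y0 = 0"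
      by (simp flip: distrib_left add: mult.assoc)
    then have "J * fx x0 y0 = fy x0 y0"
      by (simp add: imag_units_square[OF J])
    then have fy_eq: "coord J (fy x0 y0) = \<i> * coord J (fx x0 y0)"
      by (metis coord_mult_unit[OF J])
    have "((\<lambda>z. (Re z, Im z)) has_derivative (\<lambda>z. (Re z, Im z))) (at z0)"
      by (auto intro!: derivative_eq_intros)
    from diff_chain_at[OF this der[unfolded x0_def y0_def]]
    have "((\<lambda>z. ?g (Re z) (Im z)) has_derivative
        (\<lambda>z. Re z *\<^sub>R coord J (fx x0 y0) + Im z *\<^sub>R coord J (fy x0 y0))) (at z0)"
      by (simp add: x0_def y0_def o_def)
    moreover have "(\<lambda>z. Re z *\<^sub>R coord J (fx x0 y0) + Im z *\<^sub>R coord J (fy x0 y0))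
        = (*) (coord J (fx x0 y0))"
      by (auto simp: fy_eq complex_eq_iff algebra_simps)
    ultimately show ?thesis
      unfolding has_field_derivative_def emb_def by auto
  qed
  then show ?thesis
    using open_profile[OF D] by (simp add: holomorphic_on_open)
qed

text \<open>The holomorphic function may depend on the slice, since regularity is a condition on each
  slice separately.\<close>

lemma holomorphic_imp_regular:
  assumes D: "symmetric_slice_domain D"
    and hol: "\<And>J. J \<in> imag_units \<Longrightarrow> F J holomorphic_on profile D"
    and eq: "\<And>J z. J \<in> imag_units \<Longrightarrow> z \<in> profile D \<Longrightarrow> f (emb J z) = emb J (F J z)"
  shows "regular_on D f"
  unfolding regular_on_def
proof
  fix J assume J: "J \<in> imag_units"
  let ?d = "deriv (F J)"
  let ?fx = "\<lambda>x y. emb J (?d (Complex x y))" and ?fy = "\<lambda>x y. emb J (\<i> * ?d (Complex x y))"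
  note U = open_profile[OF D] and bl = bounded_linear_emb[of J]
  have V: "slice_pt J x y \<in> D \<longleftrightarrow> Complex x y \<in> profile D" for x y
    using emb_in_iff[OF D J] by (simp add: slice_pt_eq_emb)
  have hd: "?d holomorphic_on profile D"
    using hol[OF J] U by (rule holomorphic_deriv)
  have c1: "continuous_on {(x, y). slice_pt J x y \<in> D} (\<lambda>p. ?d (Complex (fst p) (snd p)))"
    by (rule continuous_on_compose2[OF holomorphic_on_imp_continuous_on[OF hd]])
      (auto simp: V Complex_eq intro!: continuous_intros)
  have chain: "((\<lambda>t. f (emb J (\<gamma> t))) has_vector_derivative emb J (c * ?d (\<gamma> s))) (at s)"
    if \<gamma>: "(\<gamma> has_vector_derivative c) (at s)" "continuous_on UNIV \<gamma>" "\<gamma> s \<in> profile D"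
    for \<gamma> :: "real \<Rightarrow> complex" and c s
  proof -
    have "((F J \<circ> \<gamma>) has_vector_derivative (c * ?d (\<gamma> s))) (at s)"
      using hol[OF J] U \<gamma> by (intro field_vector_diff_chain_at holomorphic_derivI) auto
    then have "((\<lambda>t. emb J ((F J \<circ> \<gamma>) t)) has_vector_derivative emb J (c * ?d (\<gamma> s))) (at s)"
      by (rule bounded_linear.has_vector_derivative[OF bl])
    then show ?thesis
      by (rule has_vector_derivative_transform_within_open[where S = "\<gamma> -` profile D"])
        (use \<gamma> U eq[OF J] in \<open>auto intro!: open_vimage\<close>)
  qed
  show "\<exists>fx fy.
        continuous_on {(x, y). slice_pt J x y \<in> D} (\<lambda>(x, y). fx x y) \<and>
        continuous_on {(x, y). slice_pt J x y \<in> D} (\<lambda>(x, y). fy x y) \<and>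
        (\<forall>x y. slice_pt J x y \<in> D \<longrightarrow>
           ((\<lambda>t. f (slice_pt J t y)) has_vector_derivative fx x y) (at x) \<and>
           ((\<lambda>t. f (slice_pt J x t)) has_vector_derivative fy x y) (at y) \<and>
           (1 / 2) *\<^sub>R (fx x y + J * fy x y) = 0)"
  proof (rule exI[of _ ?fx], rule exI[of _ ?fy], intro conjI allI impI)
    show "continuous_on {(x, y). slice_pt J x y \<in> D} (\<lambda>(x, y). ?fx x y)"
      using bounded_linear.continuous_on[OF bl c1] by (simp add: case_prod_unfold)
    have "continuous_on {(x, y). slice_pt J x y \<in> D} (\<lambda>p. \<i> * ?d (Complex (fst p) (snd p)))"
      by (intro continuous_on_mult continuous_on_const c1)
    from bounded_linear.continuous_on[OF bl this]
    show "continuous_on {(x, y). slice_pt J x y \<in> D} (\<lambda>(x, y). ?fy x y)"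
      by (simp add: case_prod_unfold)
    fix x y assume "slice_pt J x y \<in> D"
    then have xy: "Complex x y \<in> profile D" by (simp add: V)
    have "((\<lambda>t. Complex t y) has_vector_derivative 1) (at x)"
      unfolding Complex_eq by (auto intro!: derivative_eq_intros)
    from chain[OF this] xy
    show "((\<lambda>t. f (slice_pt J t y)) has_vector_derivative ?fx x y) (at x)"
      by (simp add: slice_pt_eq_emb Complex_eq continuous_intros)
    have "((\<lambda>t. Complex x t) has_vector_derivative \<i>) (at y)"
      unfolding Complex_eq by (auto intro!: derivative_eq_intros)
    from chain[OF this] xy
    show "((\<lambda>t. f (slice_pt J x t)) has_vector_derivative ?fy x y) (at y)"
      by (simp add: slice_pt_eq_emb Complex_eq continuous_intros)
    have "?fx x y + J * ?fy x y = ?fx x y + (J * J) * ?fx x y"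
      by (simp add: emb_i_mult[OF J] mult.assoc)
    then show "(1 / 2) *\<^sub>R (?fx x y + J * ?fy x y) = 0"
      by (simp add: imag_units_square[OF J])
  qed
qed

section \<open>Stem functions\<close>

text \<open>The classical stem function of a slice function: one complex function that describes \<open>f\<close> on all
  slices at once.\<close>

definition has_stem :: "quat set \<Rightarrow> (quat \<Rightarrow> quat) \<Rightarrow> (complex \<Rightarrow> complex) \<Rightarrow> bool" where
  "has_stem D f F \<longleftrightarrow> F holomorphic_on profile D \<and>
     (\<forall>J\<in>imag_units. \<forall>z\<in>profile D. f (emb J z) = emb J (F z))"

lemma has_stemD:
  assumes "has_stem D f F"
  shows "F holomorphic_on profile D"
    and "J \<in> imag_units \<Longrightarrow> z \<in> profile D \<Longrightarrow> f (emb J z) = emb J (F z)"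
  using assms by (auto simp: has_stem_def)

text \<open>On a real point the value of \<open>f\<close> lies in every slice plane, hence is real. So the holomorphic
  functions obtained on the different slices agree on the reals, and therefore everywhere.\<close>

lemma stem_exists:
  assumes D: "symmetric_slice_domain D" and reg: "regular_on D f" and sp: "slice_preserving D f"
  obtains F where "has_stem D f F"
proof -
  let ?F = "\<lambda>J z. coord J (f (emb J z))"
  let ?i = "Quat 0 1 0 0" and ?j = "Quat 0 0 1 0"
  have in_slice: "f (emb J z) \<in> slice_plane J" if "J \<in> imag_units" "z \<in> profile D" for J z
    using sp that emb_in_iff[OF D] by (auto simp: slice_preserving_def slice_plane_eq image_subset_iff)
  have emb_F: "f (emb J z) = emb J (?F J z)" if "J \<in> imag_units" "z \<in> profile D" for J z
    using in_slice[OF that] by (auto simp: slice_plane_eq coord_emb that)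
  have real: "?F J (of_real x) = of_real (q0 (f (of_real x)))"
    if "J \<in> imag_units" "of_real x \<in> profile D" for J x
  proof -
    have "f (of_real x) = of_real (q0 (f (of_real x)))"
      by (intro in_two_slices_real in_slice[OF _ that(2), unfolded emb_of_real] standard_imag_units)
    then have "?F J (of_real x) = coord J (emb J (of_real (q0 (f (of_real x)))))"
      unfolding emb_of_real by (rule arg_cong)
    then show ?thesis
      by (simp only: coord_emb[OF that(1)])
  qed
  have "?F J z = ?F ?i z" if "J \<in> imag_units" "z \<in> profile D" for J z
  proof (rule holomorphic_eq_on_reals[OF D _ _ _ that(2)])
    show "?F J holomorphic_on profile D" "?F ?i holomorphic_on profile D"
      using regular_imp_holomorphic[OF D reg] that(1) standard_imag_units(1) by blast+
    show "?F J (of_real x) = ?F ?i (of_real x)" if "of_real x \<in> profile D" for x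
      using real[OF \<open>J \<in> imag_units\<close> that] real[OF standard_imag_units(1) that] by metis
  qed
  then have "has_stem D f (?F ?i)"
    unfolding has_stem_def
    using regular_imp_holomorphic[OF D reg standard_imag_units(1)] emb_F by metis
  then show ?thesis using that by blast
qed

lemma has_stem_imp_slice_preserving_regular:
  assumes D: "symmetric_slice_domain D" and "has_stem D f F" and ext: "f \<in> extensional D"
  shows "f \<in> \<O>\<^sub>s D"
proof -
  note F = has_stemD[OF assms(2)]
  have "regular_on D f"
    using F by (intro holomorphic_imp_regular[OF D, of "\<lambda>_. F"])
  moreover have "slice_preserving D f"
    unfolding slice_preserving_def slice_plane_eq using F(2) emb_in_iff[OF D] by force
  ultimately show ?thesis
    using ext by (simp add: slice_preserving_regular_def PiE_def)
qed

text \<open>The point \<open>emb J (cnj z)\<close> is also \<open>emb (- J) z\<close>; evaluating \<open>f\<close> there in both ways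
  gives the symmetry.\<close>

lemma stem_cnj:
  assumes D: "symmetric_slice_domain D" and F: "has_stem D f F" and z: "z \<in> profile D"
  shows "F (cnj z) = cnj (F z)"
proof -
  let ?i = "Quat 0 1 0 0"
  note i = standard_imag_units(1)
  have "emb ?i (F (cnj z)) = f (emb ?i (cnj z))"
    using has_stemD(2)[OF F i] z profile_cnj[OF D] by simp
  also have "\<dots> = emb (- ?i) (F z)"
    using has_stemD(2)[OF F imag_units_uminus[OF i] z] by (simp add: emb_uminus)
  also have "\<dots> = emb ?i (cnj (F z))"
    by (rule emb_uminus)
  finally show ?thesis by (simp add: emb_eq_iff i)
qed

text \<open>The only ambiguity in writing a quaternion as \<open>emb J z\<close>: the imaginary part
  \<open>Im z *\<^sub>R J\<close> determines \<open>J\<close> up to sign unless it vanishes, and then \<open>J\<close> is arbitrary.\<close>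

lemma emb_eq_emb_cases:
  assumes J: "J \<in> imag_units" and K: "K \<in> imag_units" and eq: "emb J z = emb K w"
  obtains "w = z" "Im z = 0" | "w = z" "K = J" | "w = cnj z" "K = - J"
proof -
  have re: "Re w = Re z"
    and im: "q1 J * Im z = q1 K * Im w" "q2 J * Im z = q2 K * Im w" "q3 J * Im z = q3 K * Im w"
    using eq by (simp_all add: quat_eq_iff emb_sel J K)
  have "Im z * Im z * (q1 J * q1 J + q2 J * q2 J + q3 J * q3 J)
      = (q1 J * Im z) * (q1 J * Im z) + (q2 J * Im z) * (q2 J * Im z) + (q3 J * Im z) * (q3 J * Im z)"
    by (simp add: algebra_simps)
  also have "\<dots> = Im w * Im w * (q1 K * q1 K + q2 K * q2 K + q3 K * q3 K)"
    unfolding im by (simp add: algebra_simps)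
  finally have "Im z * Im z = Im w * Im w"
    by (simp add: imag_unitsD(2) J K)
  then have "Im z = Im w \<or> Im z = - Im w"
    by (simp add: square_eq_iff)
  then consider "Im z = 0" "Im w = 0" | "Im w = Im z" "Im z \<noteq> 0" | "Im w = - Im z" "Im z \<noteq> 0"
    by (cases "Im z = 0") auto
  then show ?thesis
  proof cases
    case 1
    then show ?thesis using that(1) re by (simp add: complex_eq_iff)
  next
    case 2
    then have "K = J" using im by (simp add: quat_eq_iff imag_unitsD(1) J K)
    then show ?thesis using that(2) 2 re by (simp add: complex_eq_iff)
  next
    case 3
    have "(q1 K + q1 J) * Im z = 0" "(q2 K + q2 J) * Im z = 0" "(q3 K + q3 J) * Im z = 0"
      unfolding distrib_right im 3(1) by simp_all
    then have "q1 K = - q1 J" "q2 K = - q2 J" "q3 K = - q3 J"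
      using 3(2) by (simp_all add: eq_neg_iff_add_eq_0)
    then have "K = - J" by (simp add: quat_eq_iff imag_unitsD(1) J K)
    then show ?thesis using that(3) 3 re by (simp add: complex_eq_iff)
  qed
qed

text \<open>Conjugation symmetry is exactly what makes the value \<open>emb J (F z)\<close> independent of the
  representation of a quaternion as \<open>emb J z\<close>.\<close>

lemma lift_stem:
  assumes D: "symmetric_slice_domain D" and hol: "F holomorphic_on profile D"
    and sym: "\<And>z. z \<in> profile D \<Longrightarrow> F (cnj z) = cnj (F z)"
  obtains f where "f \<in> \<O>\<^sub>s D" "has_stem D f F"
proof -
  have wd: "emb J (F z) = emb K (F w)"
    if J: "J \<in> imag_units" and K: "K \<in> imag_units" and z: "z \<in> profile D"
      and eq: "emb J z = emb K w" for J K z w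
    using J K eq
  proof (cases rule: emb_eq_emb_cases)
    case 1
    then have "cnj z = z" by (simp add: complex_eq_iff)
    then have "F z = of_real (Re (F z))"
      using sym[OF z, unfolded \<open>cnj z = z\<close>] by (simp add: complex_eq_iff)
    then show ?thesis using 1(1) emb_of_real[of _ "Re (F z)"] by simp
  next
    case 3
    then show ?thesis using sym[OF z] by (simp add: emb_uminus)
  qed simp
  define R where "R q p \<longleftrightarrow> (\<exists>J\<in>imag_units. \<exists>z\<in>profile D. q = emb J z \<and> p = emb J (F z))" for q p
  define f where "f = (\<lambda>q\<in>D. SOME p. R q p)"
  have "f (emb J z) = emb J (F z)" if Jz: "J \<in> imag_units" "z \<in> profile D" for J z
  proof -
    have "R (emb J z) (SOME p. R (emb J z) p)"
      by (rule someI[of _ "emb J (F z)"]) (use Jz in \<open>auto simp: R_def\<close>)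
    then obtain K w where "K \<in> imag_units" "emb J z = emb K w"
      and "(SOME p. R (emb J z) p) = emb K (F w)"
      unfolding R_def[of "emb J z" "SOME p. R (emb J z) p"] by blast
    moreover have "f (emb J z) = (SOME p. R (emb J z) p)"
      using Jz emb_in_iff[OF D] by (simp add: f_def)
    ultimately show ?thesis
      using wd[OF Jz(1) _ Jz(2)] by simp
  qed
  then have "has_stem D f F" using hol by (simp add: has_stem_def)
  moreover have "f \<in> extensional D" by (simp add: f_def)
  ultimately show ?thesis
    using that has_stem_imp_slice_preserving_regular[OF D] by blast
qed

lemma has_stem_restrict:
  assumes "symmetric_slice_domain D"
  shows "has_stem D (\<lambda>q\<in>D. f q) F \<longleftrightarrow> has_stem D f F"
  using emb_in_iff[OF assms] by (auto simp: has_stem_def)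

lemma slice_preserving_regular_restrict:
  assumes "symmetric_slice_domain D" "has_stem D f F"
  shows "(\<lambda>q\<in>D. f q) \<in> \<O>\<^sub>s D"
  using has_stem_imp_slice_preserving_regular[OF assms(1)] has_stem_restrict[OF assms(1)] assms(2)
  by blast

lemma has_stem_add: "has_stem D f F \<Longrightarrow> has_stem D g G \<Longrightarrow> has_stem D (\<lambda>q. f q + g q) (\<lambda>z. F z + G z)"
  and has_stem_mult: "has_stem D f F \<Longrightarrow> has_stem D g G \<Longrightarrow> has_stem D (\<lambda>q. f q * g q) (\<lambda>z. F z * G z)"
  and has_stem_scaleR: "has_stem D f F \<Longrightarrow> has_stem D (\<lambda>q. c *\<^sub>R f q) (\<lambda>z. c *\<^sub>R F z)"
  and has_stem_id: "has_stem D (\<lambda>q. q) (\<lambda>z. z)"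
  and has_stem_one: "has_stem D (\<lambda>q. 1) (\<lambda>z. 1)"
  unfolding has_stem_def
  by (auto simp: emb_add emb_mult emb_scaleR emb_1 intro!: holomorphic_intros)

lemma has_stem_compose:
  assumes D: "symmetric_slice_domain D"
    and h: "h ` D' \<subseteq> D" "has_stem D' h H" and f: "has_stem D f F"
    and D': "symmetric_slice_domain D'"
  shows "has_stem D' (\<lambda>q. f (h q)) (\<lambda>z. F (H z))"
proof -
  have H: "H z \<in> profile D" if "z \<in> profile D'" for z
    using h that emb_in_iff[OF D standard_imag_units(1)] emb_in_iff[OF D' standard_imag_units(1)]
      has_stemD(2)[OF h(2) standard_imag_units(1)] by (metis image_subset_iff)
  have "(F \<circ> H) holomorphic_on profile D'"
    using H by (intro holomorphic_on_compose_gen[OF has_stemD(1)[OF h(2)] has_stemD(1)[OF f]]) auto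
  then show ?thesis
    using H h f by (simp add: has_stem_def o_def)
qed

section \<open>The algebra of slice preserving regular functions\<close>

lemma slice_preserving_regular_stem:
  assumes "symmetric_slice_domain D" "f \<in> \<O>\<^sub>s D"
  obtains F where "has_stem D f F"
  using assms stem_exists unfolding slice_preserving_regular_def by blast

lemma slice_preserving_regular_extensional: "f \<in> \<O>\<^sub>s D \<Longrightarrow> f \<in> extensional D"
  by (simp add: slice_preserving_regular_def PiE_def)

lemma slice_preserving_regular_add:
  assumes D: "symmetric_slice_domain D" and f: "f \<in> \<O>\<^sub>s D" and g: "g \<in> \<O>\<^sub>s D"
  shows "(\<lambda>q\<in>D. f q + g q) \<in> \<O>\<^sub>s D"
proof -
  obtain F where F: "has_stem D f F" using slice_preserving_regular_stem[OF D f] .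
  obtain G where G: "has_stem D g G" using slice_preserving_regular_stem[OF D g] .
  show ?thesis
    by (rule slice_preserving_regular_restrict[OF D has_stem_add[OF F G]])
qed

lemma slice_preserving_regular_mult:
  assumes D: "symmetric_slice_domain D" and f: "f \<in> \<O>\<^sub>s D" and g: "g \<in> \<O>\<^sub>s D"
  shows "(\<lambda>q\<in>D. f q * g q) \<in> \<O>\<^sub>s D"
proof -
  obtain F where F: "has_stem D f F" using slice_preserving_regular_stem[OF D f] .
  obtain G where G: "has_stem D g G" using slice_preserving_regular_stem[OF D g] .
  show ?thesis
    by (rule slice_preserving_regular_restrict[OF D has_stem_mult[OF F G]])
qed

lemma slice_preserving_regular_scaleR:
  assumes D: "symmetric_slice_domain D" and f: "f \<in> \<O>\<^sub>s D"
  shows "(\<lambda>q\<in>D. c *\<^sub>R f q) \<in> \<O>\<^sub>s D"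
proof -
  obtain F where F: "has_stem D f F" using slice_preserving_regular_stem[OF D f] .
  show ?thesis
    by (rule slice_preserving_regular_restrict[OF D has_stem_scaleR[OF F]])
qed

lemma slice_preserving_regular_id: "symmetric_slice_domain D \<Longrightarrow> (\<lambda>q\<in>D. q) \<in> \<O>\<^sub>s D"
  and slice_preserving_regular_one: "symmetric_slice_domain D \<Longrightarrow> (\<lambda>q\<in>D. 1) \<in> \<O>\<^sub>s D"
  by (rule slice_preserving_regular_restrict; (assumption | rule has_stem_id has_stem_one))+

lemma slice_preserving_regular_compose:
  assumes D: "symmetric_slice_domain D" "symmetric_slice_domain D'"
    and h: "h ` D' \<subseteq> D" "has_stem D' h H" and f: "f \<in> \<O>\<^sub>s D"
  shows "compose D' f h \<in> \<O>\<^sub>s D'"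
  using slice_preserving_regular_stem[OF D(1) f] has_stem_compose[OF D(1) h _ D(2)]
    slice_preserving_regular_restrict[OF D(2)] unfolding compose_def by metis

section \<open>Real quadratic factors\<close>

text \<open>Polymorphic, so that the same real polynomial can be applied to complex numbers and to quaternions;
  it is then its own stem function.\<close>

definition quadratic :: "real \<Rightarrow> real \<Rightarrow> real \<Rightarrow> 'a \<Rightarrow> 'a::real_algebra_1" where
  "quadratic c2 c1 c0 x = c2 *\<^sub>R (x * x) + c1 *\<^sub>R x + c0 *\<^sub>R 1"

lemma emb_quadratic:
  "J \<in> imag_units \<Longrightarrow> emb J (quadratic c2 c1 c0 z) = quadratic c2 c1 c0 (emb J z)"
  by (simp add: quadratic_def emb_add emb_scaleR emb_mult emb_1)

lemma holomorphic_quadratic: "quadratic c2 c1 c0 holomorphic_on U"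
  unfolding quadratic_def scaleR_conv_of_real by (intro holomorphic_intros)

lemma has_stem_quadratic: "has_stem D (quadratic c2 c1 c0) (quadratic c2 c1 c0)"
  by (simp add: has_stem_def holomorphic_quadratic emb_quadratic)

lemma quadratic_cnj: "quadratic c2 c1 c0 (cnj z) = cnj (quadratic c2 c1 c0 z)"
  by (simp add: quadratic_def scaleR_conv_of_real)

text \<open>The real polynomial with roots \<open>a\<close> and \<open>cnj a\<close>. On each slice it vanishes exactly at the
  copies of these two points, so its quaternionic zeros form the sphere through \<open>a\<close>.\<close>

lemma quadratic_conjugate_roots:
  "quadratic 1 (- (2 * Re a)) (Re a * Re a + Im a * Im a) z = (z - a) * (z - cnj a)"
  by (simp add: quadratic_def complex_eq_iff algebra_simps)

lemma divide_by_root: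
  assumes "F holomorphic_on U" "open U" "F a = 0"
  obtains G where "G holomorphic_on U" "\<And>z. F z = (z - a) * G z"
  using pole_lemma_open[OF assms(1,2), of a] assms(3)
  by (intro that[of "\<lambda>z. if z = a then deriv F a else (F z - F a) / (z - a)"]) auto

text \<open>A cofactor of a real polynomial in a symmetric function can be chosen symmetric: average it with its
  conjugate \<open>\<lambda>z. cnj (G (cnj z))\<close>, which is a cofactor as well.\<close>

lemma symmetric_cofactor:
  assumes "open U" and U: "\<And>z. z \<in> U \<Longrightarrow> cnj z \<in> U"
    and G: "G holomorphic_on U"
    and R: "\<And>z. z \<in> U \<Longrightarrow> R (cnj z) = cnj (R z)"
    and eq: "\<And>z. z \<in> U \<Longrightarrow> R z = quadratic c2 c1 c0 z * G z"
  obtains G' where "G' holomorphic_on U" "\<And>z. z \<in> U \<Longrightarrow> G' (cnj z) = cnj (G' z)"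
    "\<And>z. z \<in> U \<Longrightarrow> R z = quadratic c2 c1 c0 z * G' z"
proof -
  define G' where "G' z = (G z + (cnj \<circ> G \<circ> cnj) z) / 2" for z
  have "cnj ` U = U"
    using U by (metis (no_types, lifting) complex_cnj_cnj image_eqI image_subsetI subsetI subset_antisym)
  then have "cnj \<circ> G \<circ> cnj holomorphic_on U"
    using G \<open>open U\<close> by (intro holomorphic_on_compose_cnj_cnj) simp_all
  then have "G' holomorphic_on U"
    unfolding G'_def[abs_def]
    by (intro holomorphic_on_divide holomorphic_on_add G holomorphic_on_const) (simp_all add: o_def)
  moreover have "R z = quadratic c2 c1 c0 z * G' z" if z: "z \<in> U" for z
  proof -
    have "R z = cnj (R (cnj z))" using R[OF z] by simp
    also have "\<dots> = quadratic c2 c1 c0 z * cnj (G (cnj z))"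
      using eq[OF U[OF z]] by (simp add: quadratic_cnj)
    finally have "R z + R z = quadratic c2 c1 c0 z * (G z + cnj (G (cnj z)))"
      using eq[OF z] by (simp add: distrib_left)
    then show ?thesis by (simp add: G'_def field_simps)
  qed
  moreover have "G' (cnj z) = cnj (G' z)" for z
    by (simp add: G'_def add.commute)
  ultimately show ?thesis using that by blast
qed

text \<open>A real affine function through the value \<open>F a\<close> exists because \<open>F a\<close> is real when \<open>a\<close> is.
  The remainder vanishes at \<open>a\<close>, and by symmetry at \<open>cnj a\<close>. If \<open>a\<close> is not real, both linear factors
  can be split off; if \<open>a\<close> is real, there is only one, so a linear polynomial takes the place of the
  quadratic.\<close>

lemma symmetric_interpolation:
  assumes "open U" and U: "\<And>z. z \<in> U \<Longrightarrow> cnj z \<in> U"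
    and F: "F holomorphic_on U"
    and sym: "\<And>z. z \<in> U \<Longrightarrow> F (cnj z) = cnj (F z)"
    and a: "a \<in> U"
  obtains c2 c1 c0 d1 d0 :: real and G :: "complex \<Rightarrow> complex"
  where "G holomorphic_on U" "\<And>z. z \<in> U \<Longrightarrow> G (cnj z) = cnj (G z)"
    "quadratic c2 c1 c0 a = 0"
    "\<And>z. z \<in> U \<Longrightarrow> F z = quadratic 0 d1 d0 z + quadratic c2 c1 c0 z * G z"
proof -
  \<comment> \<open>For real \<open>a\<close> the quotient is 0 by convention, and the affine function is the constant \<open>F a\<close>.\<close>
  define d1 where "d1 = Im (F a) / Im a"
  define d0 where "d0 = Re (F a) - d1 * Re a"
  define R where "R z = F z - quadratic 0 d1 d0 z" for z
  have R_hol: "R holomorphic_on U"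
    unfolding R_def by (intro holomorphic_intros F holomorphic_quadratic)
  have R_sym: "R (cnj z) = cnj (R z)" if "z \<in> U" for z
    using sym[OF that] by (simp add: R_def quadratic_cnj)
  have "Im (F a) = d1 * Im a"
  proof (cases "Im a = 0")
    case True
    then have "cnj a = a" by (simp add: complex_eq_iff)
    from sym[OF a, unfolded this] show ?thesis using True by (simp add: complex_eq_iff)
  qed (simp add: d1_def)
  then have "R a = 0"
    by (simp add: R_def quadratic_def d0_def complex_eq_iff)
  then obtain G1 where G1: "G1 holomorphic_on U" "\<And>z. R z = (z - a) * G1 z"
    using divide_by_root[OF R_hol \<open>open U\<close>] by blast
  have "\<exists>c2 c1 c0 G. G holomorphic_on U \<and> quadratic c2 c1 c0 a = 0 \<and>
      (\<forall>z\<in>U. R z = quadratic c2 c1 c0 z * G z)"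
  proof (cases "Im a = 0")
    case True
    then have "quadratic 0 1 (- Re a) z = z - a" for z
      by (simp add: quadratic_def complex_eq_iff)
    with G1 show ?thesis by (metis diff_self)
  next
    case False
    have "R (cnj a) = 0" using R_sym[OF a] \<open>R a = 0\<close> by simp
    moreover have "cnj a \<noteq> a" using False by (simp add: complex_eq_iff)
    ultimately have "G1 (cnj a) = 0" using G1(2)[of "cnj a"] by simp
    then obtain G2 where "G2 holomorphic_on U" "\<And>z. G1 z = (z - cnj a) * G2 z"
      using divide_by_root[OF G1(1) \<open>open U\<close>] by blast
    then show ?thesis
      using G1(2) quadratic_conjugate_roots[of a]
      by (intro exI[of _ 1] exI[of _ "- (2 * Re a)"] exI[of _ "Re a * Re a + Im a * Im a"] exI[of _ G2])
        (simp add: mult.assoc)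
  qed
  then obtain c2 c1 c0 G where G: "G holomorphic_on U" "quadratic c2 c1 c0 a = 0"
    "\<And>z. z \<in> U \<Longrightarrow> R z = quadratic c2 c1 c0 z * G z" by blast
  obtain G' where "G' holomorphic_on U" "\<And>z. z \<in> U \<Longrightarrow> G' (cnj z) = cnj (G' z)"
    "\<And>z. z \<in> U \<Longrightarrow> R z = quadratic c2 c1 c0 z * G' z"
    using symmetric_cofactor[OF \<open>open U\<close> U G(1) R_sym G(3)] by blast
  with that[OF _ _ G(2), of G' d1 d0] show ?thesis by (simp add: R_def algebra_simps)
qed

text \<open>Modulo the real polynomial that vanishes at \<open>p\<close>, every slice preserving regular function is a
  real affine function. This reduces evaluation of a homomorphism on \<open>f\<close> to its evaluation on
  polynomials.\<close>

lemma interpolation: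
  assumes D: "symmetric_slice_domain D" and f: "f \<in> \<O>\<^sub>s D" and p: "p \<in> D"
  obtains c2 c1 c0 d1 d0 :: real and g
  where "g \<in> \<O>\<^sub>s D" "quadratic c2 c1 c0 p = 0"
    "\<And>q. q \<in> D \<Longrightarrow> f q = quadratic 0 d1 d0 q + quadratic c2 c1 c0 q * g q"
proof -
  obtain F where F: "has_stem D f F" using slice_preserving_regular_stem[OF D f] .
  obtain J a where J: "J \<in> imag_units" and a: "a \<in> profile D" "p = emb J a"
    using domain_point[OF D p] .
  have cnj_closed: "cnj z \<in> profile D" if "z \<in> profile D" for z
    using profile_cnj[OF D] that by simp
  obtain c2 c1 c0 d1 d0 G where G: "G holomorphic_on profile D"
    "\<And>z. z \<in> profile D \<Longrightarrow> G (cnj z) = cnj (G z)"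
    "quadratic c2 c1 c0 a = 0"
    "\<And>z. z \<in> profile D \<Longrightarrow> F z = quadratic 0 d1 d0 z + quadratic c2 c1 c0 z * G z"
    by (rule symmetric_interpolation[OF open_profile[OF D] cnj_closed has_stemD(1)[OF F]
          stem_cnj[OF D F] a(1)]) (assumption | rule that; blast)+
  obtain g where g: "g \<in> \<O>\<^sub>s D" "has_stem D g G" using lift_stem[OF D G(1,2)] .
  show ?thesis
  proof (rule that[OF g(1)])
    show "quadratic c2 c1 c0 p = 0"
      unfolding a(2) by (simp add: G(3) emb_0 flip: emb_quadratic[OF J])
    fix q assume "q \<in> D"
    then obtain K z where K: "K \<in> imag_units" and z: "z \<in> profile D" "q = emb K z"
      using domain_point[OF D] by blast
    show "f q = quadratic 0 d1 d0 q + quadratic c2 c1 c0 q * g q"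
      unfolding z(2) has_stemD(2)[OF F K z(1)] has_stemD(2)[OF g(2) K z(1)] G(4)[OF z(1)]
      by (simp add: emb_add emb_mult[OF K] emb_quadratic[OF K])
  qed
qed

section \<open>Nonzero homomorphisms are compositions\<close>

locale nonzero_hom =
  fixes D D' :: "quat set" and \<phi> :: "(quat \<Rightarrow> quat) \<Rightarrow> (quat \<Rightarrow> quat)"
  assumes D: "symmetric_slice_domain D" and D': "symmetric_slice_domain D'"
    and hom: "real_algebra_hom D D' \<phi>"
    and nonzero: "\<exists>f\<in>\<O>\<^sub>s D. \<phi> f \<noteq> (\<lambda>q\<in>D'. 0)"
begin

lemma hom_closed: "f \<in> \<O>\<^sub>s D \<Longrightarrow> \<phi> f \<in> \<O>\<^sub>s D'"
  using hom by (auto simp: real_algebra_hom_def)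

lemma hom_add: "f \<in> \<O>\<^sub>s D \<Longrightarrow> g \<in> \<O>\<^sub>s D \<Longrightarrow> q \<in> D' \<Longrightarrow> \<phi> (\<lambda>q\<in>D. f q + g q) q = \<phi> f q + \<phi> g q"
  and hom_mult: "f \<in> \<O>\<^sub>s D \<Longrightarrow> g \<in> \<O>\<^sub>s D \<Longrightarrow> q \<in> D' \<Longrightarrow> \<phi> (\<lambda>q\<in>D. f q * g q) q = \<phi> f q * \<phi> g q"
  and hom_scaleR: "f \<in> \<O>\<^sub>s D \<Longrightarrow> q \<in> D' \<Longrightarrow> \<phi> (\<lambda>q\<in>D. c *\<^sub>R f q) q = c *\<^sub>R \<phi> f q"
  using hom by (simp_all add: real_algebra_hom_def)

text \<open>The stem function of \<open>\<phi> 1\<close> is continuous, idempotent and defined on a connected set, so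
  it is constantly 0 or 1. The value 0 would annihilate every \<open>\<phi> f = \<phi> f * \<phi> 1\<close>.\<close>

lemma hom_one:
  assumes "q \<in> D'"
  shows "\<phi> (\<lambda>q\<in>D. 1) q = 1"
proof -
  let ?one = "\<lambda>q\<in>D. 1 :: quat"
  note one = slice_preserving_regular_one[OF D]
  obtain E where E: "has_stem D' (\<phi> ?one) E"
    using slice_preserving_regular_stem[OF D' hom_closed[OF one]] .
  have idem: "E z \<in> {0, 1}" if z: "z \<in> profile D'" for z
  proof -
    let ?i = "Quat 0 1 0 0"
    note i = standard_imag_units(1)
    have "(\<lambda>q\<in>D. ?one q * ?one q) = ?one" by (auto intro!: restrict_ext)
    then have "\<phi> ?one (emb ?i z) * \<phi> ?one (emb ?i z) = \<phi> ?one (emb ?i z)"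
      using hom_mult[OF one one, of "emb ?i z"] emb_in_iff[OF D' i] z by simp
    then have "emb ?i (E z * E z) = emb ?i (E z)"
      by (simp add: has_stemD(2)[OF E i z] emb_mult[OF i])
    then have "E z * E z = E z" by (simp add: emb_eq_iff[OF i])
    then show ?thesis by simp
  qed
  then have "E ` profile D' \<subseteq> {0, 1}" by blast
  then have "finite (E ` profile D')" by (rule finite_subset) simp
  then have "E constant_on profile D'"
    using connected_profile[OF D'] holomorphic_on_imp_continuous_on[OF has_stemD(1)[OF E]]
    by (intro continuous_finite_range_constant)
  then obtain c where c: "\<And>z. z \<in> profile D' \<Longrightarrow> E z = c"
    unfolding constant_on_def by blast
  have val: "\<phi> ?one p = emb J c" if "J \<in> imag_units" "z \<in> profile D'" "p = emb J z" for p J z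
    using has_stemD(2)[OF E that(1,2)] c that by simp
  obtain J z where Jz: "J \<in> imag_units" "z \<in> profile D'" "q = emb J z"
    using domain_point[OF D' assms] .
  have "c \<noteq> 0"
  proof
    assume "c = 0"
    have "\<phi> f = (\<lambda>q\<in>D'. 0)" if f: "f \<in> \<O>\<^sub>s D" for f
    proof (rule extensionalityI[of _ D'])
      show "\<phi> f \<in> extensional D'"
        by (rule slice_preserving_regular_extensional[OF hom_closed[OF f]])
      fix p assume p: "p \<in> D'"
      obtain K w where "K \<in> imag_units" "w \<in> profile D'" "p = emb K w"
        using domain_point[OF D' p] .
      then have "\<phi> ?one p = 0" using val \<open>c = 0\<close> by (simp add: emb_0)
      moreover have "(\<lambda>q\<in>D. f q * ?one q) = f"
        using slice_preserving_regular_extensional[OF f]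
        by (intro extensionalityI[of _ D]) auto
      ultimately show "\<phi> f p = (\<lambda>q\<in>D'. 0) p"
        using hom_mult[OF f one p] p by simp
    qed simp
    with nonzero show False by blast
  qed
  with c[OF Jz(2)] idem[OF Jz(2)] have "c = 1" by auto
  then show ?thesis using val[OF Jz] by (simp add: emb_1)
qed

text \<open>The image of the coordinate function, which will turn out to be the map that \<open>\<phi>\<close> composes with.\<close>

definition point_map :: "quat \<Rightarrow> quat" where "point_map = \<phi> (\<lambda>q\<in>D. q)"

lemma point_map_regular: "point_map \<in> \<O>\<^sub>s D'"
  unfolding point_map_def by (intro hom_closed slice_preserving_regular_id D)

lemma quadratic_regular: "(\<lambda>q\<in>D. quadratic c2 c1 c0 q) \<in> \<O>\<^sub>s D"
  by (rule slice_preserving_regular_restrict[OF D has_stem_quadratic])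

lemma hom_quadratic:
  assumes q: "q \<in> D'"
  shows "\<phi> (\<lambda>q\<in>D. quadratic c2 c1 c0 q) q = quadratic c2 c1 c0 (point_map q)"
proof -
  define x where "x = (\<lambda>q\<in>D. q)"
  define e where "e = (\<lambda>q\<in>D. 1 :: quat)"
  define s where "s = (\<lambda>q\<in>D. x q * x q)"
  define t2 where "t2 = (\<lambda>q\<in>D. c2 *\<^sub>R s q)"
  define t1 where "t1 = (\<lambda>q\<in>D. c1 *\<^sub>R x q)"
  define t0 where "t0 = (\<lambda>q\<in>D. c0 *\<^sub>R e q)"
  define u where "u = (\<lambda>q\<in>D. t2 q + t1 q)"
  note defs = x_def e_def s_def t2_def t1_def t0_def u_def
  have x: "x \<in> \<O>\<^sub>s D" and e: "e \<in> \<O>\<^sub>s D"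
    using slice_preserving_regular_id[OF D] slice_preserving_regular_one[OF D]
    by (simp_all add: x_def e_def)
  have s: "s \<in> \<O>\<^sub>s D"
    unfolding s_def by (intro slice_preserving_regular_mult D x)
  have t: "t2 \<in> \<O>\<^sub>s D" "t1 \<in> \<O>\<^sub>s D" "t0 \<in> \<O>\<^sub>s D"
    unfolding t2_def t1_def t0_def by (intro slice_preserving_regular_scaleR D x e s)+
  have u: "u \<in> \<O>\<^sub>s D"
    unfolding u_def by (intro slice_preserving_regular_add D t)
  have "(\<lambda>q\<in>D. quadratic c2 c1 c0 q) = (\<lambda>q\<in>D. u q + t0 q)"
    by (rule restrict_ext) (simp add: defs quadratic_def)
  then have "\<phi> (\<lambda>q\<in>D. quadratic c2 c1 c0 q) q = \<phi> u q + \<phi> t0 q"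
    by (simp add: hom_add[OF u t(3) q])
  also have "\<phi> u q = \<phi> t2 q + \<phi> t1 q"
    unfolding u_def by (rule hom_add[OF t(1,2) q])
  also have "\<phi> t2 q = c2 *\<^sub>R \<phi> s q"
    unfolding t2_def by (rule hom_scaleR[OF s q])
  also have "\<phi> t1 q = c1 *\<^sub>R \<phi> x q"
    unfolding t1_def by (rule hom_scaleR[OF x q])
  also have "\<phi> t0 q = c0 *\<^sub>R \<phi> e q"
    unfolding t0_def by (rule hom_scaleR[OF e q])
  also have "\<phi> s q = \<phi> x q * \<phi> x q"
    unfolding s_def by (rule hom_mult[OF x x q])
  finally show ?thesis
    by (simp only: quadratic_def point_map_def x_def e_def hom_one[OF q])
qed

text \<open>A value \<open>a\<close> outside \<open>D\<close> has its whole sphere outside \<open>D\<close>, so the real quadratic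
  with that zero set is a unit of \<open>\<O>\<^sub>s D\<close>, whereas its image under \<open>\<phi>\<close> vanishes where the value
  \<open>a\<close> is taken.\<close>

lemma point_map_in:
  assumes q: "q \<in> D'"
  shows "point_map q \<in> D"
proof (rule ccontr)
  assume "point_map q \<notin> D"
  obtain J z where J: "J \<in> imag_units" and z: "z \<in> profile D'" "q = emb J z"
    using domain_point[OF D' q] .
  obtain H where H: "has_stem D' point_map H"
    using slice_preserving_regular_stem[OF D' point_map_regular] .
  define a where "a = H z"
  have hq: "point_map q = emb J a"
    using has_stemD(2)[OF H J z(1)] z(2) by (simp add: a_def)
  have a: "a \<notin> profile D"
    using \<open>point_map q \<notin> D\<close> emb_in_iff[OF D J] by (simp add: hq)
  let ?p = "quadratic 1 (- (2 * Re a)) (Re a * Re a + Im a * Im a)"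
  have p_nz: "?p w \<noteq> (0::complex)" if "w \<in> profile D" for w
    using that a profile_cnj[OF D, of a] by (auto simp: quadratic_conjugate_roots)
  have "(\<lambda>w. 1 / ?p w) holomorphic_on profile D"
    by (intro holomorphic_intros holomorphic_quadratic p_nz)
  then obtain g where g: "g \<in> \<O>\<^sub>s D" "has_stem D g (\<lambda>w. 1 / ?p w)"
    by (rule lift_stem[OF D]) (simp add: quadratic_cnj)
  let ?f = "\<lambda>q\<in>D. ?p q"
  have "(\<lambda>q\<in>D. ?f q * g q) = (\<lambda>q\<in>D. 1)"
  proof (rule restrict_ext)
    fix p assume "p \<in> D"
    then obtain K w where K: "K \<in> imag_units" and w: "w \<in> profile D" "p = emb K w"
      using domain_point[OF D] by blast
    have "?p p * g p = emb K (?p w * (1 / ?p w))"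
      unfolding w(2) has_stemD(2)[OF g(2) K w(1)] by (simp only: emb_mult[OF K] emb_quadratic[OF K])
    also have "\<dots> = 1"
      using p_nz[OF w(1)] by (simp add: emb_1)
    finally show "?f p * g p = 1"
      using \<open>p \<in> D\<close> by simp
  qed
  then have "\<phi> ?f q * \<phi> g q = 1"
    using hom_mult[OF quadratic_regular g(1) q] hom_one[OF q] by metis
  moreover have "\<phi> ?f q = emb J (?p a)"
    by (simp only: hom_quadratic[OF q] hq emb_quadratic[OF J])
  then have "\<phi> ?f q = 0"
    by (simp add: quadratic_conjugate_roots emb_0)
  ultimately show False by simp
qed

text \<open>Write \<open>f\<close> as an affine function plus a multiple of a polynomial that vanishes at
  \<open>point_map q\<close>; the multiple contributes nothing at \<open>q\<close>, neither to \<open>\<phi> f\<close> nor to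
  \<open>f \<circ> point_map\<close>.\<close>

lemma hom_eq_evaluation:
  assumes f: "f \<in> \<O>\<^sub>s D" and q: "q \<in> D'"
  shows "\<phi> f q = f (point_map q)"
proof -
  obtain c2 c1 c0 d1 d0 g where g: "g \<in> \<O>\<^sub>s D" and root: "quadratic c2 c1 c0 (point_map q) = 0"
    and eq: "\<And>p. p \<in> D \<Longrightarrow> f p = quadratic 0 d1 d0 p + quadratic c2 c1 c0 p * g p"
    by (rule interpolation[OF D f point_map_in[OF q]]) (rule that; blast)
  let ?l = "\<lambda>q\<in>D. quadratic 0 d1 d0 q" and ?p = "\<lambda>q\<in>D. quadratic c2 c1 c0 q"
  let ?m = "\<lambda>q\<in>D. ?p q * g q"
  have "f = (\<lambda>q\<in>D. ?l q + ?m q)"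
    using slice_preserving_regular_extensional[OF f] eq
    by (intro extensionalityI[of _ D]) auto
  then have "\<phi> f q = \<phi> ?l q + \<phi> ?m q"
    using hom_add[OF quadratic_regular slice_preserving_regular_mult[OF D quadratic_regular g] q]
    by metis
  also have "\<dots> = quadratic 0 d1 d0 (point_map q)"
    unfolding hom_mult[OF quadratic_regular g q] hom_quadratic[OF q] root by simp
  also have "\<dots> = f (point_map q)"
    using eq[OF point_map_in[OF q]] root by simp
  finally show ?thesis .
qed

lemma point_map_PiE: "point_map \<in> D' \<rightarrow>\<^sub>E D"
  using point_map_in slice_preserving_regular_extensional[OF point_map_regular] by (simp add: PiE_def)

lemma hom_eq_compose: "f \<in> \<O>\<^sub>s D \<Longrightarrow> \<phi> f = compose D' f point_map"
  using slice_preserving_regular_extensional[OF hom_closed]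
  by (intro extensionalityI[of _ D']) (simp_all add: hom_eq_evaluation compose_eq)

section \<open>Bijective homomorphisms and bi-regular maps\<close>

lemma inverse_hom:
  assumes bij: "bij_betw \<phi> (\<O>\<^sub>s D) (\<O>\<^sub>s D')"
  shows "nonzero_hom D' D (the_inv_into (\<O>\<^sub>s D) \<phi>)"
proof -
  let ?\<psi> = "the_inv_into (\<O>\<^sub>s D) \<phi>"
  have inj: "inj_on \<phi> (\<O>\<^sub>s D)" and im: "\<phi> ` \<O>\<^sub>s D = \<O>\<^sub>s D'"
    using bij by (auto simp: bij_betw_def)
  have \<psi>: "?\<psi> g \<in> \<O>\<^sub>s D" "\<phi> (?\<psi> g) = g" if "g \<in> \<O>\<^sub>s D'" for g
    using the_inv_into_into[OF inj _ subset_refl] f_the_inv_into_f[OF inj] that im by auto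
  have \<psi>_eqI: "?\<psi> g = f" if "f \<in> \<O>\<^sub>s D" "\<phi> f = g" for f g
    using the_inv_into_f_eq[OF inj that(2,1)] .
  have hom_eqs: "\<phi> (\<lambda>q\<in>D. f q + g q) = (\<lambda>q\<in>D'. \<phi> f q + \<phi> g q)"
    "\<phi> (\<lambda>q\<in>D. f q * g q) = (\<lambda>q\<in>D'. \<phi> f q * \<phi> g q)"
    if "f \<in> \<O>\<^sub>s D" "g \<in> \<O>\<^sub>s D" for f g
    using hom that by (auto simp: real_algebra_hom_def)
  have hom_scaleR_eq: "\<phi> (\<lambda>q\<in>D. c *\<^sub>R f q) = (\<lambda>q\<in>D'. c *\<^sub>R \<phi> f q)" if "f \<in> \<O>\<^sub>s D" for f c
    using hom that by (auto simp: real_algebra_hom_def)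
  have "real_algebra_hom D' D ?\<psi>"
    unfolding real_algebra_hom_def
  proof (intro conjI ballI allI)
    fix f g c assume f: "f \<in> \<O>\<^sub>s D'" and g: "g \<in> \<O>\<^sub>s D'"
    show "?\<psi> (\<lambda>q\<in>D'. f q + g q) = (\<lambda>q\<in>D. ?\<psi> f q + ?\<psi> g q)"
      by (rule \<psi>_eqI) (use \<psi> f g in \<open>simp_all add: hom_eqs slice_preserving_regular_add[OF D]\<close>)
    show "?\<psi> (\<lambda>q\<in>D'. f q * g q) = (\<lambda>q\<in>D. ?\<psi> f q * ?\<psi> g q)"
      by (rule \<psi>_eqI) (use \<psi> f g in \<open>simp_all add: hom_eqs slice_preserving_regular_mult[OF D]\<close>)
  next
    fix f c assume f: "f \<in> \<O>\<^sub>s D'"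
    show "?\<psi> (\<lambda>q\<in>D'. c *\<^sub>R f q) = (\<lambda>q\<in>D. c *\<^sub>R ?\<psi> f q)"
      by (rule \<psi>_eqI) (use \<psi> f in \<open>simp_all add: hom_scaleR_eq slice_preserving_regular_scaleR[OF D]\<close>)
  qed (use \<psi> in auto)
  moreover have "\<exists>g\<in>\<O>\<^sub>s D'. ?\<psi> g \<noteq> (\<lambda>q\<in>D. 0)"
  proof
    let ?one = "\<lambda>q\<in>D. 1 :: quat"
    note one = slice_preserving_regular_one[OF D]
    show "\<phi> ?one \<in> \<O>\<^sub>s D'" by (rule hom_closed[OF one])
    obtain p where "p \<in> D"
      using D by (auto simp: symmetric_slice_domain_def domain_in_def)
    then have "?one p \<noteq> (\<lambda>q\<in>D. 0) p" by simp
    then show "?\<psi> (\<phi> ?one) \<noteq> (\<lambda>q\<in>D. 0)"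
      unfolding \<psi>_eqI[OF one refl] by metis
  qed
  ultimately show ?thesis
    using D D' by unfold_locales
qed

text \<open>The inverse homomorphism is also a composition, with some map \<open>D \<rightarrow> D'\<close>. Testing both
  homomorphisms on each other's point map shows that the two maps are mutually inverse.\<close>

lemma biregular_if_bij:
  assumes bij: "bij_betw \<phi> (\<O>\<^sub>s D) (\<O>\<^sub>s D')"
  shows "biregular D' D point_map"
proof -
  let ?\<psi> = "the_inv_into (\<O>\<^sub>s D) \<phi>"
  interpret inv: nonzero_hom D' D ?\<psi> using bij by (rule inverse_hom)
  have inj: "inj_on \<phi> (\<O>\<^sub>s D)" and im: "\<phi> ` \<O>\<^sub>s D = \<O>\<^sub>s D'"
    using bij by (auto simp: bij_betw_def)
  have kh: "inv.point_map (point_map q) = q" if q: "q \<in> D'" for q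
  proof -
    have "\<phi> inv.point_map = (\<lambda>q\<in>D'. q)"
      unfolding inv.point_map_def using slice_preserving_regular_id[OF D'] im
      by (intro f_the_inv_into_f[OF inj]) simp
    with hom_eq_evaluation[OF inv.point_map_regular q] q show ?thesis by simp
  qed
  have hk: "point_map (inv.point_map p) = p" if p: "p \<in> D" for p
  proof -
    have "?\<psi> point_map = (\<lambda>q\<in>D. q)"
      unfolding point_map_def by (intro the_inv_into_f_f[OF inj] slice_preserving_regular_id[OF D])
    with inv.hom_eq_evaluation[OF point_map_regular p] p show ?thesis by simp
  qed
  have bij_h: "bij_betw point_map D' D"
    by (rule bij_betw_byWitness[where f' = inv.point_map]) (use kh hk point_map_in inv.point_map_in in auto)
  obtain K where K: "has_stem D inv.point_map K"
    using slice_preserving_regular_stem[OF D inv.point_map_regular] .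
  have "the_inv_into D' point_map p = inv.point_map p" if "p \<in> D" for p
    using bij_h hk inv.point_map_in that by (intro the_inv_into_f_eq) (auto simp: bij_betw_def)
  then have "the_inv_into D' point_map (emb J z) = emb J (K z)" if "J \<in> imag_units" "z \<in> profile D" for J z
    using has_stemD(2)[OF K that] emb_in_iff[OF D] that by simp
  then have "regular_on D (the_inv_into D' point_map)"
    using has_stemD(1)[OF K] by (intro holomorphic_imp_regular[OF D, of "\<lambda>_. K"])
  then show ?thesis
    using point_map_regular bij_h by (simp add: biregular_def slice_preserving_regular_def)
qed

text \<open>A nonreal value of a slice preserving map determines the slice of its preimage. A real value at
  \<open>emb K w\<close> is also taken at \<open>emb K (cnj w)\<close>, so injectivity forces \<open>w\<close> to be real, and real points lie
  in every slice.\<close>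

lemma slice_preserving_inverse:
  assumes inj: "inj_on point_map D'" and im: "point_map ` D' = D"
  shows "slice_preserving D (the_inv_into D' point_map)"
  unfolding slice_preserving_def slice_plane_eq
proof (intro ballI image_subsetI)
  fix J q assume J: "J \<in> imag_units" and q: "q \<in> D \<inter> range (emb J)"
  let ?k = "the_inv_into D' point_map"
  obtain H where H: "has_stem D' point_map H"
    using slice_preserving_regular_stem[OF D' point_map_regular] .
  obtain z where z: "q = emb J z" using q by blast
  have k: "?k q \<in> D'" "point_map (?k q) = q"
    using q im the_inv_into_into[OF inj _ subset_refl] f_the_inv_into_f[OF inj] by auto
  obtain K w where K: "K \<in> imag_units" and w: "w \<in> profile D'" "?k q = emb K w"
    using domain_point[OF D' k(1)] .
  have "emb K (H w) = point_map (?k q)"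
    unfolding w(2) by (rule has_stemD(2)[OF H K w(1), symmetric])
  also have "\<dots> = emb J z"
    using k(2) z by simp
  finally have "emb K (H w) = emb J z" .
  with K J show "?k q \<in> range (emb J)"
  proof (cases rule: emb_eq_emb_cases)
    case 1
    then have "cnj (H w) = H w" by (simp add: complex_eq_iff)
    then have "point_map (emb K (cnj w)) = point_map (emb K w)"
      using has_stemD(2)[OF H K] w(1) profile_cnj[OF D'] stem_cnj[OF D' H w(1)] by simp
    then have "emb K (cnj w) = emb K w"
      using inj w(1) profile_cnj[OF D'] emb_in_iff[OF D' K] by (auto dest: inj_onD)
    then have "cnj w = w" by (simp add: emb_eq_iff[OF K])
    then have "w = of_real (Re w)" by (simp add: complex_eq_iff)
    then have "?k q = emb J (of_real (Re w))"
      unfolding w(2) emb_of_real by (metis emb_of_real)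
    then show ?thesis by blast
  next
    case 2
    then show ?thesis using w(2) by simp
  next
    case 3
    then have "?k q = emb J (cnj w)" using w(2) emb_uminus[of K "cnj w"] by simp
    then show ?thesis by blast
  qed
qed

text \<open>Composition with the inverse of \<open>point_map\<close> stays inside the slice preserving regular
  functions and inverts \<open>\<phi>\<close>.\<close>

lemma bij_if_biregular:
  assumes "biregular D' D point_map"
  shows "bij_betw \<phi> (\<O>\<^sub>s D) (\<O>\<^sub>s D')"
proof -
  let ?k = "the_inv_into D' point_map"
  have inj: "inj_on point_map D'" and im: "point_map ` D' = D" and reg: "regular_on D ?k"
    using assms by (auto simp: biregular_def bij_betw_def)
  have k: "?k q \<in> D'" "point_map (?k q) = q" if "q \<in> D" for q
    using that im the_inv_into_into[OF inj _ subset_refl] f_the_inv_into_f[OF inj] by auto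
  obtain K where K: "has_stem D ?k K"
    using stem_exists[OF D reg slice_preserving_inverse[OF inj im]] .
  have comp: "compose D g ?k \<in> \<O>\<^sub>s D" if "g \<in> \<O>\<^sub>s D'" for g
    using k(1) by (intro slice_preserving_regular_compose[OF D' D _ K that]) auto
  show ?thesis
  proof (rule bij_betw_byWitness[where f' = "\<lambda>g. compose D g ?k"])
    show "\<forall>f\<in>\<O>\<^sub>s D. compose D (\<phi> f) ?k = f"
    proof
      fix f assume f: "f \<in> \<O>\<^sub>s D"
      show "compose D (\<phi> f) ?k = f"
        using slice_preserving_regular_extensional[OF f]
        by (intro extensionalityI[of _ D]) (simp_all add: compose_eq hom_eq_evaluation[OF f] k)
    qed
    show "\<forall>g\<in>\<O>\<^sub>s D'. \<phi> (compose D g ?k) = g"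
    proof
      fix g assume g: "g \<in> \<O>\<^sub>s D'"
      show "\<phi> (compose D g ?k) = g"
        using slice_preserving_regular_extensional[OF g]
          slice_preserving_regular_extensional[OF hom_closed[OF comp[OF g]]]
        by (intro extensionalityI[of _ D'])
          (simp_all add: compose_eq hom_eq_evaluation[OF comp[OF g]] point_map_in the_inv_into_f_f[OF inj])
    qed
  qed (use hom_closed comp in auto)
qed

end

theorem theorem5p7:
  fixes D D' :: "quat set" and \<phi> :: "(quat \<Rightarrow> quat) \<Rightarrow> (quat \<Rightarrow> quat)"
  assumes "symmetric_slice_domain D" and "symmetric_slice_domain D'"
    and "real_algebra_hom D D' \<phi>"
    and nonzero: "\<exists>f\<in>\<O>\<^sub>s D. \<phi> f \<noteq> (\<lambda>q\<in>D'. 0)"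
  shows "(\<exists>!h. h \<in> D' \<rightarrow>\<^sub>E D \<and> (\<forall>f\<in>\<O>\<^sub>s D. \<phi> f = compose D' f h)) \<and>
    (\<forall>h. h \<in> D' \<rightarrow>\<^sub>E D \<and> (\<forall>f\<in>\<O>\<^sub>s D. \<phi> f = compose D' f h) \<longrightarrow>
       h = \<phi> (\<lambda>q\<in>D. q) \<and> h \<in> \<O>\<^sub>s D' \<and>
       (bij_betw \<phi> (\<O>\<^sub>s D) (\<O>\<^sub>s D') \<longleftrightarrow> biregular D' D h))"
proof -
  interpret nonzero_hom D D' \<phi> using assms by unfold_locales
  have unique: "k = point_map" if k: "k \<in> D' \<rightarrow>\<^sub>E D" "\<forall>f\<in>\<O>\<^sub>s D. \<phi> f = compose D' f k" for k
  proof -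
    have "point_map = compose D' (\<lambda>q\<in>D. q) k"
      using k(2) slice_preserving_regular_id[OF D] unfolding point_map_def by blast
    also have "\<dots> = k"
      using k(1) by (intro extensionalityI[of _ D']) (auto simp: compose_eq PiE_def)
    finally show ?thesis ..
  qed
  have "\<exists>!k. k \<in> D' \<rightarrow>\<^sub>E D \<and> (\<forall>f\<in>\<O>\<^sub>s D. \<phi> f = compose D' f k)"
    using point_map_PiE hom_eq_compose unique by (intro ex1I[of _ point_map]) auto
  moreover have "bij_betw \<phi> (\<O>\<^sub>s D) (\<O>\<^sub>s D') \<longleftrightarrow> biregular D' D point_map"
    using biregular_if_bij bij_if_biregular by blast
  ultimately show ?thesis
    using unique point_map_regular point_map_def by metis
qed

end
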